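(* Let $\mathbb{E}_1,\mathbb{E}_2$ be Euclidean spaces, let $K\subset\mathbb{E}_2$, $K\ne\{0\}$, be a closed, convex cone such that $K\subset-K^\circ$, and let $F:\mathbb{E}_1\to\mathbb{E}_2^\bullet$ be proper, $K$-convex and $K$-closed. Assume that $K=\mathrm{cone}\{b_1,\dots,b_N\}$ for $b_1,\dots,b_N\in\mathrm{rge}\,F$, and that, for every $i=1,\dots,N$, there exists a nonempty convex set $C^{b_i}\subset F^{-1}(\mathbb{R}_+b_i)$ such that the function $f_{b_i}:=\langle b_i,F\rangle+\delta_{C^{b_i}}$ is $C^{b_i}$-closed and does not have any affine majorant on $C^{b_i}$. Then $K\text{-}\mathrm{epi}\,F=\overline{\mathrm{conv}}(\mathrm{gph}\,F)$.
   Context: A Euclidean space is a finite-dimensional real inner product space. A cone is a nonempty set $K$ with $\lambda x\in K$ for all $\lambda\ge0$, $x\in K$. $K^\circ:=\{v : \langle u,v\rangle\le0\ \forall u\in K\}$. $\mathrm{cone}\,S$ is the convex conical hull of $S$, $\mathbb{R}_+u=\{\lambda u : \lambda\ge0\}$. $\mathbb{E}_2^\bullet:=\mathbb{E}_2\cup\{+\infty_\bullet\}$ with a formal largest element; $\mathrm{dom}\,F:=\{x : F(x)\in\mathbb{E}_2\}$, $\mathrm{rge}\,F:=F(\mathrm{dom}\,F)$, $\mathrm{gph}\,F:=\{(x,F(x)) : x\in\mathrm{dom}\,F\}$, $K\text{-}\mathrm{epi}\,F:=\{(x,y)\in\mathrm{dom}\,F\times\mathbb{E}_2 : y-F(x)\in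 K\}$. $F$ is proper if $\mathrm{dom}\,F\neq\emptyset$, $K$-convex (resp. $K$-closed) if $K\text{-}\mathrm{epi}\,F$ is convex (resp. closed in $\mathbb{E}_1\times\mathbb{E}_2$). $\overline{\mathrm{conv}}$ is the closed convex hull. $\langle u,F\rangle(x)=\langle u,F(x)\rangle$ for $x\in\mathrm{dom}\,F$ and $+\infty$ otherwise; $\delta_C$ is $0$ on $C$ and $+\infty$ elsewhere. For convex $C\subset\mathbb{E}_1$, $f:\mathbb{E}_1\to\mathbb{R}\cup\{+\infty\}$ is $C$-closed if its epigraph $\{(x,\alpha)\in\mathbb{E}_1\times\mathbb{R} : f(x)\le\alpha\}$ is closed in the subspace topology of $C\times\mathbb{R}$ (for $\mathrm{dom}\,f=C$, as here: $\liminf_k f(x_k)\ge f(\bar x)$ whenever $x_k\in C$, $x_k\to\bar x\in C$). An affine majorant of $f$ on $C$ is an affine function $\phi:\mathbb{E}_1\to\mathbb{R}$ with $f(x)\le\phi(x)$ for all $x\in C$. *)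

theory Defs
  imports "HOL-Analysis.Analysis"
begin

text \<open>
  A map from \<open>E1\<close> to \<open>E2 \<union> {+\<infinity>\<^sub>\<bullet>}\<close> is a partial function \<open>F :: 'a \<rightharpoonup> 'b\<close>, with \<open>None\<close> in the
  role of \<open>+\<infinity>\<^sub>\<bullet>\<close>. Its domain, range and graph are then \<^const>\<open>dom\<close>, \<^const>\<open>ran\<close> and
  \<^const>\<open>Map.graph\<close>.
\<close>

definition proper :: "('a \<rightharpoonup> 'b) \<Rightarrow> bool" where
  "proper F \<longleftrightarrow> dom F \<noteq> {}"

definition K_epi :: "'b::ab_group_add set \<Rightarrow> ('a \<rightharpoonup> 'b) \<Rightarrow> ('a \<times> 'b) set" where
  "K_epi K F = {(x, y). x \<in> dom F \<and> y - the (F x) \<in> K}"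

definition K_convex :: "'b::real_vector set \<Rightarrow> ('a::real_vector \<rightharpoonup> 'b) \<Rightarrow> bool" where
  "K_convex K F \<longleftrightarrow> convex (K_epi K F)"

definition K_closed :: "'b::euclidean_space set \<Rightarrow> ('a::euclidean_space \<rightharpoonup> 'b) \<Rightarrow> bool" where
  "K_closed K F \<longleftrightarrow> closed (K_epi K F)"

definition polar_cone :: "'a::real_inner set \<Rightarrow> 'a set" where
  "polar_cone K = {v. \<forall>u\<in>K. u \<bullet> v \<le> 0}"

definition nonneg_ray :: "'a::real_vector \<Rightarrow> 'a set" where
  "nonneg_ray u = {t *\<^sub>R u | t. t \<ge> 0}"

definition scalarization :: "'b::real_inner \<Rightarrow> ('a \<rightharpoonup> 'b) \<Rightarrow> 'a \<Rightarrow> ereal" where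
  "scalarization u F x = (case F x of Some y \<Rightarrow> ereal (u \<bullet> y) | None \<Rightarrow> \<infinity>)"

definition indicator_inf :: "'a set \<Rightarrow> 'a \<Rightarrow> ereal" where
  "indicator_inf C x = (if x \<in> C then 0 else \<infinity>)"

definition ereal_epi :: "('a \<Rightarrow> ereal) \<Rightarrow> ('a \<times> real) set" where
  "ereal_epi f = {(x, \<alpha>). f x \<le> ereal \<alpha>}"

text \<open>
  \<^const>\<open>closedin\<close> includes the requirement that the epigraph lies in \<open>C \<times> \<real>\<close>, i.e. that \<open>f\<close> is
  \<open>+\<infinity>\<close> off \<open>C\<close>.
\<close>

definition rel_closed_fun :: "'a::euclidean_space set \<Rightarrow> ('a \<Rightarrow> ereal) \<Rightarrow> bool" where
  "rel_closed_fun C f \<longleftrightarrow> closedin (top_of_set (C \<times> UNIV)) (ereal_epi f)"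

definition affine_fun :: "('a::real_vector \<Rightarrow> real) \<Rightarrow> bool" where
  "affine_fun \<phi> \<longleftrightarrow> (\<exists>l c. linear l \<and> \<phi> = (\<lambda>x. l x + c))"

definition affine_majorant_on ::
    "'a::real_vector set \<Rightarrow> ('a \<Rightarrow> ereal) \<Rightarrow> ('a \<Rightarrow> real) \<Rightarrow> bool" where
  "affine_majorant_on C f \<phi> \<longleftrightarrow> affine_fun \<phi> \<and> (\<forall>x\<in>C. f x \<le> ereal (\<phi> x))"

end

theory Submission
  imports Defs
begin

text \<open>
  The graph of \<open>F\<close> lies in the closed convex set \<open>K_epi K F\<close>, so only the inclusion of \<open>K_epi K F\<close>
  in \<open>D = closure (convex hull (Map.graph F))\<close> has content. It says that \<open>D\<close> absorbs the
  directions \<open>(0, k)\<close> with \<open>k \<in> K\<close>, and by duality this is a statement about the half-spaces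
  containing \<open>D\<close>. If \<open>(x, F x + k) \<notin> D\<close>, a strictly separating functional \<open>(u, v)\<close> is bounded above
  on the graph although \<open>v \<bullet> k > 0\<close>. Since the \<open>b i\<close> generate \<open>K\<close>, also \<open>v \<bullet> b i > 0\<close> for some \<open>i\<close>.
  On the corresponding set \<open>C\<close> the values of \<open>F\<close> are multiples of \<open>b i\<close>, hence determined by
  \<open>b i \<bullet> F\<close>; the bound on \<open>(u, v)\<close> can then be solved for \<open>b i \<bullet> F\<close> and becomes an affine majorant
  (lemma \<open>affine_majorant_of_half_space\<close>), which is excluded.
\<close>

lemma graph_subset_K_epi:
  assumes "0 \<in> K"
  shows "Map.graph F \<subseteq> K_epi K F"
  using assms by (auto simp: Map.graph_def K_epi_def)

text \<open>
  On \<open>C\<close> one has \<open>F x = t x *\<^sub>R b\<close>, so the half-space inequality reads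
  \<open>t x * (v \<bullet> b) \<le> \<alpha> - u \<bullet> x\<close>. Dividing by \<open>v \<bullet> b > 0\<close> and multiplying by \<open>b \<bullet> b\<close> bounds
  \<open>b \<bullet> F x = t x * (b \<bullet> b)\<close> by an affine function of \<open>x\<close>.
\<close>

lemma affine_majorant_of_half_space:
  fixes F :: "'a::real_inner \<rightharpoonup> 'b::real_inner"
  assumes half_space: "\<And>x y. F x = Some y \<Longrightarrow> u \<bullet> x + v \<bullet> y \<le> \<alpha>"
    and pos: "v \<bullet> b > 0"
    and ray: "C \<subseteq> F -` (Some ` nonneg_ray b)"
  shows "\<exists>\<phi>. affine_majorant_on C (\<lambda>x. scalarization b F x + indicator_inf C x) \<phi>"
proof -
  define r where "r = (b \<bullet> b) / (v \<bullet> b)"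
  have "r \<ge> 0"
    using pos by (simp add: r_def)
  define \<phi> where "\<phi> = (\<lambda>x. (- r) * (u \<bullet> x) + r * \<alpha>)"
  have "linear (\<lambda>x. (- r) * (u \<bullet> x))"
    by (rule linearI) (simp_all add: inner_right_distrib algebra_simps)
  then have "affine_fun \<phi>"
    unfolding affine_fun_def \<phi>_def by blast
  moreover have "scalarization b F x + indicator_inf C x \<le> ereal (\<phi> x)" if "x \<in> C" for x
  proof -
    obtain t where t: "F x = Some (t *\<^sub>R b)"
      using ray \<open>x \<in> C\<close> by (auto simp: nonneg_ray_def)
    have "t * (b \<bullet> b) = r * (t * (v \<bullet> b))"
      using pos by (simp add: r_def)
    also have "\<dots> \<le> r * (\<alpha> - u \<bullet> x)"
      using half_space[OF t] \<open>r \<ge> 0\<close> by (intro mult_left_mono) auto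
    finally have "t * (b \<bullet> b) \<le> \<phi> x"
      by (simp add: \<phi>_def algebra_simps)
    then show ?thesis
      using \<open>x \<in> C\<close> t by (simp add: scalarization_def indicator_inf_def)
  qed
  ultimately show ?thesis
    unfolding affine_majorant_on_def by blast
qed

lemma convex_cone_hull_generator_inner_pos:
  fixes v :: "'a::real_inner"
  assumes "k \<in> convex_cone hull S" and "v \<bullet> k > 0"
  obtains s where "s \<in> S" and "v \<bullet> s > 0"
proof -
  have "\<not> S \<subseteq> {z. v \<bullet> z \<le> 0}"
  proof
    assume "S \<subseteq> {z. v \<bullet> z \<le> 0}"
    then have "convex_cone hull S \<subseteq> {z. v \<bullet> z \<le> 0}"
      by (rule hull_minimal) (rule convex_cone_halfspace_le)
    then show False
      using assms by force
  qed
  then show thesis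
    using that by fastforce
qed

theorem proposition46:
  fixes K :: "'b::euclidean_space set"
    and F :: "'a::euclidean_space \<rightharpoonup> 'b"
    and b :: "nat \<Rightarrow> 'b"
    and N :: nat
  assumes "closed K" and "convex_cone K" and "K \<noteq> {0}"
    and "K \<subseteq> uminus ` polar_cone K"
    and "proper F" and "K_convex K F" and "K_closed K F"
    and "\<forall>i\<in>{1..N}. b i \<in> ran F"
    and "K = convex_cone hull (b ` {1..N})"
    and "\<forall>i\<in>{1..N}. \<exists>C. C \<noteq> {} \<and> convex C \<and> C \<subseteq> F -` (Some ` nonneg_ray (b i)) \<and>
           rel_closed_fun C (\<lambda>x. scalarization (b i) F x + indicator_inf C x) \<and>
           \<not> (\<exists>\<phi>. affine_majorant_on C (\<lambda>x. scalarization (b i) F x + indicator_inf C x) \<phi>)"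
  shows "K_epi K F = closure (convex hull (Map.graph F))"
proof
  let ?D = "closure (convex hull (Map.graph F))"
  have "0 \<in> K"
    using \<open>convex_cone K\<close> by (rule convex_cone_contains_0)
  then have "convex hull (Map.graph F) \<subseteq> K_epi K F"
    using \<open>K_convex K F\<close> by (simp add: K_convex_def graph_subset_K_epi hull_minimal)
  then show "?D \<subseteq> K_epi K F"
    using \<open>K_closed K F\<close> by (simp add: K_closed_def closure_minimal)
  have graph_in_D: "(x, y) \<in> ?D" if "F x = Some y" for x y
    using that closure_subset hull_subset[of "Map.graph F" convex] in_graphI by fastforce
  show "K_epi K F \<subseteq> ?D"
  proof (rule ccontr)
    assume "\<not> K_epi K F \<subseteq> ?D"
    then obtain x y k where xy: "F x = Some y" and k: "k \<in> K" and notin: "(x, y + k) \<notin> ?D"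
    proof -
      obtain x z where "(x, z) \<in> K_epi K F" "(x, z) \<notin> ?D"
        using \<open>\<not> K_epi K F \<subseteq> ?D\<close> by auto
      then show thesis
        using that[of x "the (F x)" "z - the (F x)"] by (auto simp: K_epi_def)
    qed
    obtain w \<beta> where w: "w \<bullet> (x, y + k) < \<beta>" "\<And>z. z \<in> ?D \<Longrightarrow> w \<bullet> z > \<beta>"
      using separating_hyperplane_closed_point[OF _ _ notin]
      by (metis convex_closure convex_convex_hull closed_closure)
    \<comment> \<open>The separation theorem puts \<open>?D\<close> on the upper side, hence the change of sign.\<close>
    define u v where "u = - fst w" and "v = - snd w"
    have below: "u \<bullet> x' + v \<bullet> y' \<le> - \<beta>" if "F x' = Some y'" for x' y'
      using w(2)[OF graph_in_D[OF that]] by (simp add: u_def v_def inner_prod_def)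
    have "v \<bullet> k > 0"
      using w(1) below[OF xy] by (simp add: u_def v_def inner_prod_def inner_right_distrib)
    then obtain i where i: "i \<in> {1..N}" "v \<bullet> b i > 0"
      using convex_cone_hull_generator_inner_pos[of k "b ` {1..N}" v] k assms(9) by blast
    then obtain C where "C \<subseteq> F -` (Some ` nonneg_ray (b i))"
      "\<not> (\<exists>\<phi>. affine_majorant_on C (\<lambda>x. scalarization (b i) F x + indicator_inf C x) \<phi>)"
      using assms(10) by blast
    then show False
      using affine_majorant_of_half_space[OF below i(2)] by blast
  qed
qed

end
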